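(* Let $A\in\mathbb{R}^{N\times N}$, $C\in\mathbb{R}^{M'\times N}$ with $(C,A)$ observable, and let $Q\in\mathbb{R}^{N\times N}$, $R\in\mathbb{R}^{M'\times M'}$ be symmetric positive definite. Assume $(A,Q,C,R)$ is a class $\mathcal{A}$ system, i.e. every $X\in\mathbb{S}_+^N$ with $X\succeq f_0(P^\ast)$ satisfies $f_1(X)\preceq X$. Then for all $M>0$, $$\limsup_{\overline{\gamma}\uparrow 1}\left(-\frac{1}{\ln(1-\overline{\gamma})}\ln\mu^{\overline{\gamma}}\left(\{X\in\mathbb{S}_+^N\mid\|X-P^\ast\|\ge M\}\right)\right)\le-\iota(M)$$ and $$\liminf_{\overline{\gamma}\uparrow 1}\left(-\frac{1}{\ln(1-\overline{\gamma})}\ln\mu^{\overline{\gamma}}\left(\{X\in\mathbb{S}_+^N\mid\|X-P^\ast\|> M\}\right)\right)\ge-\iota_+(M),$$ where $$\iota(M)=\inf\{k\in\{0,1,2,\dots\}\mid\|f_0^k(P^\ast)-P^\ast\|\ge M\},\qquad \iota_+(M)=\inf\{k\in\{0,1,2,\dots\}\mid\|f_0^k(P^\ast)-P^\ast\|> M\}.$$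
   Context: $\mathbb{S}_+^N$ is the set of real symmetric positive semidefinite $N\times N$ matrices with the metric induced by the spectral norm $\|\cdot\|$; $X\preceq Y$ means $Y-X$ is positive semidefinite. Define $f_0,f_1:\mathbb{S}_+^N\to\mathbb{S}_+^N$ by $f_0(X)=AXA^T+Q$ and $f_1(X)=AXA^T+Q-AXC^T(CXC^T+R)^{-1}CXA^T$; $f_0^k$ is the $k$-fold composition. $P^\ast$ is the unique fixed point of $f_1$ in $\mathbb{S}_+^N$. For $\overline{\gamma}\in(0,1)$, let $\{\gamma_t\}_{t\ge0}$ be i.i.d. Bernoulli with $\mathbb{P}(\gamma_t=1)=\overline{\gamma}$ and consider the Markov chain $P_{t+1}=f_{\gamma_t}(P_t)$ on $\mathbb{S}_+^N$; $\mu^{\overline{\gamma}}$ is its unique invariant probability measure, to which the law of $P_t$ converges weakly from every initial $P_0\in\mathbb{S}_+^N$ (such a measure exists and is unique under the stated hypotheses). Conventions: the infimum of an empty set is $\infty$; $\ln0=-\infty$. *)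

theory Defs
  imports "HOL-Probability.Probability"
begin

text \<open>Matrices are over \<^typ>\<open>real\<close> with type-indexed dimensions. The type class operations
  \<open>*\<close>, \<open>^\<close> and \<open>norm\<close> on \<^typ>\<open>real^'n^'n\<close> are the componentwise product, its powers and the
  Frobenius norm, so matrix powers and the spectral norm are defined separately.\<close>

definition mat_power :: "real^'n^'n \<Rightarrow> nat \<Rightarrow> real^'n^'n" where
  "mat_power A k = ((\<lambda>X. A ** X) ^^ k) (mat 1)"

text \<open>Operator norm induced by the Euclidean vector norm.\<close>

definition spectral_norm :: "real^'n^'n \<Rightarrow> real" where
  "spectral_norm X = onorm (\<lambda>v. X *v v)"

definition psd :: "(real^'n^'n) set" where
  "psd = {X. transpose X = X \<and> (\<forall>v. 0 \<le> v \<bullet> (X *v v))}"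

definition pos_definite :: "real^'n^'n \<Rightarrow> bool" where
  "pos_definite X \<longleftrightarrow> transpose X = X \<and> (\<forall>v. v \<noteq> 0 \<longrightarrow> 0 < v \<bullet> (X *v v))"

definition loewner_le :: "real^'n^'n \<Rightarrow> real^'n^'n \<Rightarrow> bool"  (infix "\<preceq>\<^sub>L" 50) where
  "X \<preceq>\<^sub>L Y \<longleftrightarrow> Y - X \<in> psd"

text \<open>The observability matrix stacks the blocks \<open>C, C A, \<dots>, C A\<^sup>N\<^sup>-\<^sup>1\<close>, where \<open>N\<close> is the order
  of \<open>A\<close>; its (row) rank is the dimension of the span of the rows of all the blocks.\<close>

definition observable :: "real^'n^'m \<Rightarrow> real^'n^'n \<Rightarrow> bool" where
  "observable C A \<longleftrightarrow>
     dim (\<Union>k<CARD('n). rows (C ** mat_power A k)) = CARD('n)"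

definition f0 :: "real^'n^'n \<Rightarrow> real^'n^'n \<Rightarrow> real^'n^'n \<Rightarrow> real^'n^'n" where
  "f0 A Q X = A ** X ** transpose A + Q"

definition f1 :: "real^'n^'n \<Rightarrow> real^'n^'n \<Rightarrow> real^'n^'m \<Rightarrow> real^'m^'m \<Rightarrow>
    real^'n^'n \<Rightarrow> real^'n^'n" where
  "f1 A Q C R X =
     A ** X ** transpose A + Q
     - A ** X ** transpose C ** matrix_inv (C ** X ** transpose C + R) ** C ** X ** transpose A"

text \<open>Here \<open>P\<close> is meant to be the fixed point of \<open>f1 A Q C R\<close> in \<^const>\<open>psd\<close>.\<close>

definition class_A :: "real^'n^'n \<Rightarrow> real^'n^'n \<Rightarrow> real^'n^'m \<Rightarrow> real^'m^'m \<Rightarrow>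
    real^'n^'n \<Rightarrow> bool" where
  "class_A A Q C R P \<longleftrightarrow>
     (\<forall>X\<in>psd. f0 A Q P \<preceq>\<^sub>L X \<longrightarrow> f1 A Q C R X \<preceq>\<^sub>L X)"

text \<open>The spectral norm is equivalent to the Frobenius norm, so it induces the Borel
  \<open>\<sigma>\<close>-algebra of the type.\<close>

definition psd_borel :: "(real^'n^'n) measure" where
  "psd_borel = restrict_space borel psd"

text \<open>Transition kernel of \<open>P\<^sub>t\<^sub>+\<^sub>1 = f\<^sub>\<gamma> P\<^sub>t\<close> with an independent Bernoulli
  variable \<open>\<gamma>\<close>, equal to 1 (i.e. \<^const>\<open>True\<close>) with probability \<open>g\<close>.\<close>

definition riccati_kernel :: "real^'n^'n \<Rightarrow> real^'n^'n \<Rightarrow> real^'n^'m \<Rightarrow> real^'m^'m \<Rightarrow>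
    real \<Rightarrow> real^'n^'n \<Rightarrow> (real^'n^'n) measure" where
  "riccati_kernel A Q C R g X =
     distr (measure_pmf (bernoulli_pmf g)) psd_borel
       (\<lambda>b. if b then f1 A Q C R X else f0 A Q X)"

definition invariant_prob :: "real^'n^'n \<Rightarrow> real^'n^'n \<Rightarrow> real^'n^'m \<Rightarrow> real^'m^'m \<Rightarrow>
    real \<Rightarrow> (real^'n^'n) measure \<Rightarrow> bool" where
  "invariant_prob A Q C R g \<mu> \<longleftrightarrow>
     sets \<mu> = sets psd_borel \<and> prob_space \<mu> \<and>
     (\<forall>B\<in>sets psd_borel.
        emeasure \<mu> B = (\<integral>\<^sup>+ X. emeasure (riccati_kernel A Q C R g X) B \<partial>\<mu>))"

definition ext_ln :: "real \<Rightarrow> ereal" where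
  "ext_ln p = (if p = 0 then -\<infinity> else ereal (ln p))"

text \<open>In \<^typ>\<open>ereal\<close> the infimum of the empty set is \<open>\<infinity>\<close>.\<close>

definition iota :: "real^'n^'n \<Rightarrow> real^'n^'n \<Rightarrow> real^'n^'n \<Rightarrow> real \<Rightarrow> ereal" where
  "iota A Q P M =
     Inf {ereal (real k) | k. spectral_norm ((f0 A Q ^^ k) P - P) \<ge> M}"

definition iota_plus :: "real^'n^'n \<Rightarrow> real^'n^'n \<Rightarrow> real^'n^'n \<Rightarrow> real \<Rightarrow> ereal" where
  "iota_plus A Q P M =
     Inf {ereal (real k) | k. spectral_norm ((f0 A Q ^^ k) P - P) > M}"

end

theory Submission
  imports Defs "HOL-Real_Asymp.Real_Asymp"
begin

text \<open>
  By completing the square, \<open>v \<bullet> f1 X v\<close> is a minimum over \<open>u\<close> of a cost that is affine and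
  monotone in \<open>X\<close>. Hence \<open>f1\<close> is monotone and concave, and since \<open>(1 - r) P \<preceq> Q\<close> for some
  \<open>r < 1\<close>, it maps \<open>{X. (1 - s) P \<preceq> X}\<close> and \<open>{X. X \<preceq> (1 + s) P}\<close> into the same sets with \<open>s r\<close>
  for \<open>s\<close>. Observability allows the state to be steered to zero in \<open>N\<close> steps at a cost that does not
  depend on \<open>X\<close>, so \<open>f1\<^sup>N\<close> is bounded on the whole cone, and \<open>f1\<^sup>l\<close> converges to \<open>P\<close> uniformly.

  Lower bound: if \<open>f0\<^sup>k P\<close> lies in an open set \<open>G\<close>, then for some \<open>l\<close> the map \<open>f0\<^sup>k f1\<^sup>l\<close> takes the
  whole cone into \<open>G\<close>, so invariance gives \<open>\<mu> G \<ge> g\<^sup>l (1 - g)\<^sup>k\<close>.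
  Upper bound: suppose that every word in \<open>f0, f1\<close> with fewer than \<open>k\<close> letters \<open>f0\<close> takes \<open>P\<close> into the
  open set \<open>G\<close>. If \<open>f1\<^sup>l\<close> takes the cone into \<open>G\<close>, a chain outside \<open>G\<close> has used \<open>f0\<close> in one of its last
  \<open>l\<close> steps, say followed by \<open>i\<close> letters \<open>f1\<close>, and was just before outside the preimage of \<open>G\<close>
  under \<open>f1\<^sup>i f0\<close>, which satisfies the assumption with \<open>k - 1\<close>. By induction the mass outside \<open>G\<close> is
  \<open>O((1 - g)\<^sup>k)\<close>.
  For a class A system \<open>P \<preceq> w P \<preceq> f0\<^sup>j P\<close> for every word \<open>w\<close> with \<open>j\<close> letters \<open>f0\<close>, so the assumption
  holds for the spectral ball of radius \<open>M\<close> about \<open>P\<close> and every \<open>k \<le> iota M\<close>.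
\<close>

text \<open>As a simp rule this turns \<open>transpose B *v x\<close> into \<open>x v* B\<close>;
  adjoints are kept in the first form below.\<close>

declare transpose_matrix_vector [simp del]

section \<open>Positive semidefinite matrices and the spectral norm\<close>

lemma inner_matrix_vector_left: "(B *v x) \<bullet> y = x \<bullet> (transpose B *v y)" for B :: "real^'n^'m"
  by (metis dot_lmul_matrix transpose_transpose transpose_matrix_vector)

lemma psd_symmetric: "X \<in> psd \<Longrightarrow> transpose X = X"
  and psd_nonneg: "X \<in> psd \<Longrightarrow> 0 \<le> v \<bullet> (X *v v)"
  by (auto simp: psd_def)

lemma transpose_add: "transpose (X + Y) = transpose X + transpose Y"
  and transpose_minus: "transpose (X - Y) = transpose X - transpose Y"
  for X Y :: "real^'n^'m"
  by (simp_all add: transpose_def vec_eq_iff)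

lemma scaleR_matrix_vector: "(c *\<^sub>R X) *v v = c *\<^sub>R (X *v v)" for X :: "real^'n^'m"
  by (simp add: scaleR_matrix_vector_assoc)

lemma loewner_le_iff:
  assumes "transpose X = X" "transpose Y = Y"
  shows "X \<preceq>\<^sub>L Y \<longleftrightarrow> (\<forall>v. v \<bullet> (X *v v) \<le> v \<bullet> (Y *v v))"
  using assms
  by (auto simp: loewner_le_def psd_def transpose_minus matrix_vector_mult_diff_rdistrib inner_diff_right)

lemma loewner_leD: "X \<preceq>\<^sub>L Y \<Longrightarrow> v \<bullet> (X *v v) \<le> v \<bullet> (Y *v v)"
  by (auto simp: loewner_le_def psd_def matrix_vector_mult_diff_rdistrib inner_diff_right)

lemma psd_add: "X \<in> psd \<Longrightarrow> Y \<in> psd \<Longrightarrow> X + Y \<in> psd"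
  by (auto simp: psd_def transpose_add matrix_vector_mult_add_rdistrib inner_add_right)

lemma psd_0: "0 \<in> psd"
  by (auto simp: psd_def transpose_def vec_eq_iff)

lemma pos_definite_imp_psd: "pos_definite X \<Longrightarrow> X \<in> psd"
  unfolding psd_def pos_definite_def
  by (auto intro: less_imp_le) (metis inner_zero_left less_imp_le order_refl)

lemma loewner_le_refl: "X \<preceq>\<^sub>L X"
  by (simp add: loewner_le_def psd_0)

lemma loewner_le_trans: "X \<preceq>\<^sub>L Y \<Longrightarrow> Y \<preceq>\<^sub>L Z \<Longrightarrow> X \<preceq>\<^sub>L Z"
  unfolding loewner_le_def using psd_add by fastforce

text \<open>A discriminant argument: the form at \<open>s *\<^sub>R v + t *\<^sub>R w\<close> is
  nonnegative for all \<open>s\<close> and \<open>t\<close>.\<close>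

lemma psd_cauchy_schwarz:
  assumes "X \<in> psd"
  shows "(v \<bullet> (X *v w))\<^sup>2 \<le> (v \<bullet> (X *v v)) * (w \<bullet> (X *v w))"
proof -
  let ?a = "w \<bullet> (X *v w)" and ?b = "v \<bullet> (X *v w)" and ?c = "v \<bullet> (X *v v)"
  have sym: "w \<bullet> (X *v v) = ?b"
    using assms inner_matrix_vector_left[of X w v] by (simp add: psd_symmetric inner_commute)
  have exp: "0 \<le> s\<^sup>2 * ?c + 2 * s * t * ?b + t\<^sup>2 * ?a" for s t
  proof -
    have "0 \<le> (s *\<^sub>R v + t *\<^sub>R w) \<bullet> (X *v (s *\<^sub>R v + t *\<^sub>R w))"
      using assms by (rule psd_nonneg)
    also have "\<dots> = s\<^sup>2 * ?c + 2 * s * t * ?b + t\<^sup>2 * ?a"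
      by (simp add: matrix_vector_right_distrib matrix_vector_mult_scaleR inner_add_left
          inner_add_right sym power2_eq_square algebra_simps)
    finally show ?thesis .
  qed
  have "0 \<le> ?a" "0 \<le> ?c" using assms by (auto intro: psd_nonneg)
  show ?thesis
  proof (cases "?a = 0")
    case True
    have "?b = 0"
    proof (rule ccontr)
      assume "?b \<noteq> 0"
      \<comment> \<open>With \<open>?a = 0\<close> and \<open>s = 1\<close> the expression is affine
        in \<open>t\<close>; this \<open>t\<close> makes it -1.\<close>
      then show False
        using exp[of 1 "- (?c + 1) / (2 * ?b)"] True by (simp add: field_simps)
    qed
    then show ?thesis using True by simp
  next
    case False
    with \<open>0 \<le> ?a\<close> have a: "0 < ?a" by simp
    have "0 \<le> ?a * (?a * ?c - ?b\<^sup>2)"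
      using exp[of "?a" "- ?b"] by (simp add: power2_eq_square algebra_simps)
    with a have "0 \<le> ?a * ?c - ?b\<^sup>2" by (simp add: zero_le_mult_iff)
    then show ?thesis by (simp add: mult.commute)
  qed
qed

section \<open>Spectral norm: comparison with the Frobenius norm and monotonicity\<close>

lemma norm_matrix_vector_le: "norm (X *v v) \<le> spectral_norm X * norm v"
  unfolding spectral_norm_def by (rule onorm) (rule matrix_vector_mul_bounded_linear)

lemma spectral_norm_nonneg: "0 \<le> spectral_norm X"
  unfolding spectral_norm_def by (rule onorm_pos_le) (rule matrix_vector_mul_bounded_linear)

lemma spectral_norm_triangle: "spectral_norm (X + Y) \<le> spectral_norm X + spectral_norm Y"
  unfolding spectral_norm_def
  using onorm_triangle[OF matrix_vector_mul_bounded_linear matrix_vector_mul_bounded_linear, of X Y]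
  by (simp add: matrix_vector_mult_add_rdistrib[abs_def])

lemma spectral_norm_scaleR: "spectral_norm (c *\<^sub>R X) = \<bar>c\<bar> * spectral_norm X"
  unfolding spectral_norm_def
  using onorm_scaleR[OF matrix_vector_mul_bounded_linear, of c X]
  by (simp add: scaleR_matrix_vector[abs_def])

lemma spectral_norm_le_norm:
  fixes X :: "real^'n^'n"
  shows "spectral_norm X \<le> (real CARD('n))\<^sup>2 * norm X"
proof -
  have "spectral_norm X \<le> real CARD('n) * real CARD('n) * norm X"
    unfolding spectral_norm_def
    by (rule onorm_le_matrix_component) (meson Finite_Cartesian_Product.norm_nth_le order_trans
        component_le_norm_cart)
  then show ?thesis by (simp add: power2_eq_square)
qed

lemma norm_le_spectral_norm:
  fixes X :: "real^'n^'n"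
  shows "norm X \<le> (real CARD('n))\<^sup>2 * spectral_norm X"
proof -
  have "norm X \<le> (\<Sum>i\<in>UNIV. norm (X $ i))"
    unfolding norm_vec_def by (rule L2_set_le_sum) simp
  also have "\<dots> \<le> (\<Sum>i\<in>(UNIV::'n set). \<Sum>j\<in>(UNIV::'n set). spectral_norm X)"
  proof (rule sum_mono)
    fix i
    have "norm (X $ i) \<le> (\<Sum>j\<in>UNIV. \<bar>X $ i $ j\<bar>)" by (rule norm_le_l1_cart)
    also have "\<dots> \<le> (\<Sum>j\<in>(UNIV::'n set). spectral_norm X)"
      unfolding spectral_norm_def by (rule sum_mono) (rule matrix_component_le_onorm)
    finally show "norm (X $ i) \<le> (\<Sum>j\<in>(UNIV::'n set). spectral_norm X)" .
  qed
  finally show ?thesis by (simp add: power2_eq_square mult.assoc)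
qed

lemma continuous_on_spectral_norm [continuous_intros]:
  fixes f :: "'a::topological_space \<Rightarrow> real^'n^'n"
  assumes "continuous_on S f"
  shows "continuous_on S (\<lambda>x. spectral_norm (f x))"
proof -
  have "((real CARD('n))\<^sup>2)-lipschitz_on UNIV (spectral_norm :: real^'n^'n \<Rightarrow> real)"
  proof (rule lipschitz_onI)
    fix X Y :: "real^'n^'n"
    have "spectral_norm X \<le> spectral_norm Y + (real CARD('n))\<^sup>2 * norm (X - Y)" for X Y :: "real^'n^'n"
      using spectral_norm_triangle[of Y "X - Y"] spectral_norm_le_norm[of "X - Y"] by simp
    from this[of X Y] this[of Y X]
    show "dist (spectral_norm X) (spectral_norm Y) \<le> (real CARD('n))\<^sup>2 * dist X Y"
      by (simp add: dist_norm norm_minus_commute abs_le_iff)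
  qed simp
  then have "continuous_on UNIV (spectral_norm :: real^'n^'n \<Rightarrow> real)"
    by (rule lipschitz_on_continuous_on)
  then show ?thesis using assms by (rule continuous_on_compose2) auto
qed

text \<open>Cauchy-Schwarz for the form of \<open>D\<close>, applied to \<open>D *v w\<close> and
  \<open>w\<close>, bounds the fourth power of \<open>norm (D *v w)\<close> by two values of that
  form, both controlled by \<open>E\<close>.\<close>

lemma spectral_norm_mono:
  assumes D: "D \<in> psd" and DE: "D \<preceq>\<^sub>L E"
  shows "spectral_norm D \<le> spectral_norm E"
proof -
  have form: "w \<bullet> (D *v w) \<le> spectral_norm E * (norm w)\<^sup>2" for w
  proof -
    have "w \<bullet> (D *v w) \<le> w \<bullet> (E *v w)" using DE by (rule loewner_leD)
    also have "\<dots> \<le> norm w * norm (E *v w)" by (rule norm_cauchy_schwarz)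
    also have "\<dots> \<le> norm w * (spectral_norm E * norm w)"
      by (intro mult_left_mono norm_matrix_vector_le norm_ge_zero)
    finally show ?thesis by (simp add: power2_eq_square mult_ac)
  qed
  show ?thesis
    unfolding spectral_norm_def[of D]
  proof (rule onorm_le)
    fix w
    let ?d = "norm (D *v w)"
    have "(?d\<^sup>2)\<^sup>2 = ((D *v w) \<bullet> (D *v w))\<^sup>2"
      by (simp add: power2_norm_eq_inner)
    also have "\<dots> \<le> ((D *v w) \<bullet> (D *v (D *v w))) * (w \<bullet> (D *v w))"
      using D by (rule psd_cauchy_schwarz)
    also have "\<dots> \<le> (spectral_norm E * ?d\<^sup>2) * (spectral_norm E * (norm w)\<^sup>2)"
      by (intro mult_mono form psd_nonneg[OF D] mult_nonneg_nonneg spectral_norm_nonneg) simp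
    finally have *: "?d\<^sup>2 * ?d\<^sup>2 \<le> ?d\<^sup>2 * (spectral_norm E * norm w)\<^sup>2"
      by (simp add: power2_eq_square mult_ac)
    have "?d\<^sup>2 \<le> (spectral_norm E * norm w)\<^sup>2"
    proof (cases "?d = 0")
      case False
      then have "0 < ?d\<^sup>2" by simp
      with * show ?thesis using mult_le_cancel_left_pos by blast
    qed simp
    then show "?d \<le> spectral_norm E * norm w"
      by (rule power2_le_imp_le) (simp add: spectral_norm_nonneg)
  qed
qed

section \<open>Positive definite matrices, inverses and continuity\<close>

lemma pos_definite_coercive:
  fixes X :: "real^'n^'n"
  assumes "pos_definite X"
  obtains c where "0 < c" "\<And>v. c * (norm v)\<^sup>2 \<le> v \<bullet> (X *v v)"
proof -
  let ?S = "sphere (0 :: real^'n) 1"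
  have "axis undefined 1 \<in> ?S" by simp
  then have "?S \<noteq> {}" by blast
  moreover have "continuous_on ?S (\<lambda>v. v \<bullet> (X *v v))"
    by (intro continuous_intros)
  ultimately obtain u where u: "u \<in> ?S" "\<forall>v\<in>?S. u \<bullet> (X *v u) \<le> v \<bullet> (X *v v)"
    using continuous_attains_inf[OF compact_sphere] by blast
  have "u \<noteq> 0" using u by auto
  then have "0 < u \<bullet> (X *v u)" using assms by (simp add: pos_definite_def)
  moreover have "u \<bullet> (X *v u) * (norm v)\<^sup>2 \<le> v \<bullet> (X *v v)" for v
  proof (cases "v = 0")
    case False
    let ?v = "(1 / norm v) *\<^sub>R v"
    have "?v \<in> ?S" using False by simp
    then have "u \<bullet> (X *v u) \<le> ?v \<bullet> (X *v ?v)" using u(2) by blast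
    also have "\<dots> = v \<bullet> (X *v v) / (norm v)\<^sup>2"
      by (simp only: matrix_vector_mult_scaleR inner_scaleR_left inner_scaleR_right)
        (simp add: power2_eq_square)
    finally show ?thesis using False by (simp add: field_simps)
  qed simp
  ultimately show thesis by (rule that)
qed

lemma pos_definite_add_psd: "X \<in> psd \<Longrightarrow> pos_definite Y \<Longrightarrow> pos_definite (X + Y)"
  by (auto simp: pos_definite_def psd_def transpose_add matrix_vector_mult_add_rdistrib
      inner_add_right add_nonneg_pos)

lemma psd_congruence:
  fixes B :: "real^'n^'m"
  assumes "X \<in> psd"
  shows "B ** X ** transpose B \<in> psd"
proof -
  have "v \<bullet> ((B ** X ** transpose B) *v v) = (transpose B *v v) \<bullet> (X *v (transpose B *v v))" for v
    by (simp add: inner_matrix_vector_left matrix_vector_mul_assoc matrix_mul_assoc)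
  then show ?thesis
    using assms by (auto simp: psd_def matrix_transpose_mul matrix_mul_assoc)
qed

lemma pos_definite_invertible:
  assumes "pos_definite X"
  shows "invertible X"
proof -
  have "x = 0" if "X *v x = 0" for x
    using assms that unfolding pos_definite_def by (metis inner_zero_right less_irrefl)
  then show ?thesis
    using matrix_left_invertible_ker invertible_left_inverse by blast
qed

lemma matrix_inv_mult:
  assumes "invertible X"
  shows "X ** matrix_inv X = mat 1" "matrix_inv X ** X = mat 1"
  using assms someI_ex[of "\<lambda>Y. X ** Y = mat 1 \<and> Y ** X = mat 1"]
  by (auto simp: invertible_def matrix_inv_def)

lemma transpose_matrix_inv:
  fixes X :: "real^'n^'n"
  assumes "invertible X" "transpose X = X"
  shows "transpose (matrix_inv X) = matrix_inv X"
proof -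
  have "transpose (matrix_inv X) ** X = mat 1"
    by (metis assms matrix_inv_mult(1) matrix_transpose_mul transpose_mat)
  then show ?thesis
    by (metis assms(1) matrix_inv_mult(1) matrix_mul_assoc matrix_mul_lid matrix_mul_rid)
qed

lemma continuous_on_matrix_mult [continuous_intros]:
  fixes f :: "'a::topological_space \<Rightarrow> real^'n^'m" and g :: "'a \<Rightarrow> real^'k^'n"
  assumes "continuous_on S f" "continuous_on S g"
  shows "continuous_on S (\<lambda>x. f x ** g x)"
  unfolding matrix_matrix_mult_def
  by (intro continuous_on_vec_lambda continuous_intros assms)

lemma continuous_on_det [continuous_intros]:
  fixes f :: "'a::topological_space \<Rightarrow> real^'n^'n"
  assumes "continuous_on S f"
  shows "continuous_on S (\<lambda>x. det (f x))"
  unfolding det_def by (intro continuous_intros assms)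

text \<open>Cramer's rule gives each entry of the inverse as a quotient of determinants that depend
  continuously on \<open>x\<close>.\<close>

lemma continuous_on_matrix_inv [continuous_intros]:
  fixes f :: "'a::topological_space \<Rightarrow> real^'n^'n"
  assumes f: "continuous_on S f" and inv: "\<And>x. x \<in> S \<Longrightarrow> invertible (f x)"
  shows "continuous_on S (\<lambda>x. matrix_inv (f x))"
proof -
  have entry: "matrix_inv (f x) $ k $ l =
      det (\<chi> i j. if j = k then axis l 1 $ i else f x $ i $ j) / det (f x)" if "x \<in> S" for x k l
  proof -
    have d: "det (f x) \<noteq> 0" using inv[OF that] by (simp add: invertible_det_nz)
    have "f x *v (matrix_inv (f x) *v axis l 1) = axis l 1"
      by (simp add: matrix_vector_mul_assoc matrix_inv_mult inv that)
    then have "matrix_inv (f x) *v axis l 1 =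
        (\<chi> k. det (\<chi> i j. if j = k then axis l 1 $ i else f x $ i $ j) / det (f x))"
      using cramer[OF d] by blast
    then show ?thesis
      by (simp add: matrix_vector_mult_basis column_def vec_eq_iff)
  qed
  have "continuous_on S (\<lambda>x. \<chi> k l.
      det (\<chi> i j. if j = k then axis l 1 $ i else f x $ i $ j) / det (f x))"
  proof (intro continuous_on_vec_lambda continuous_on_divide continuous_on_det f ballI)
    fix i j k l
    show "continuous_on S (\<lambda>x. if j = k then axis l 1 $ i else f x $ i $ j)"
      by (cases "j = k") (auto intro!: continuous_intros f)
  qed (use inv invertible_det_nz in blast)
  then show ?thesis
    by (rule continuous_on_eq) (simp add: entry vec_eq_iff)
qed

section \<open>The Riccati maps\<close>

lemma linear_funpow_matrix: "linear (((*v) B) ^^ n)" for B :: "real^'n^'n"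
proof (induction n)
  case (Suc n)
  then show ?case unfolding funpow.simps by (rule linear_compose) (rule matrix_vector_mul_linear)
qed (simp add: linear_iff)

locale riccati =
  fixes A Q :: "real^'n^'n" and C :: "real^'n^'m" and R :: "real^'m^'m"
  assumes Q_pos: "pos_definite Q" and R_pos: "pos_definite R"
begin

abbreviation F0 :: "real^'n^'n \<Rightarrow> real^'n^'n" where "F0 \<equiv> f0 A Q"

abbreviation F1 :: "real^'n^'n \<Rightarrow> real^'n^'n" where "F1 \<equiv> f1 A Q C R"

text \<open>If \<open>K\<close> is any estimator gain and \<open>u = transpose K *v v\<close>, then \<open>cost X v u\<close> is the quadratic
  form at \<open>v\<close> of the error covariance obtained from \<open>X\<close> with that gain.\<close>

definition cost :: "real^'n^'n \<Rightarrow> real^'n \<Rightarrow> real^'m \<Rightarrow> real" where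
  "cost X v u =
     (transpose A *v v - transpose C *v u) \<bullet> (X *v (transpose A *v v - transpose C *v u)) +
     v \<bullet> (Q *v v) + u \<bullet> (R *v u)"

lemma Q_psd: "Q \<in> psd" and R_psd: "R \<in> psd"
  using Q_pos R_pos by (auto intro: pos_definite_imp_psd)

lemma innovation_pos_definite: "X \<in> psd \<Longrightarrow> pos_definite (C ** X ** transpose C + R)"
  by (intro pos_definite_add_psd psd_congruence R_pos)

lemma f0_form: "v \<bullet> (F0 X *v v) = (transpose A *v v) \<bullet> (X *v (transpose A *v v)) + v \<bullet> (Q *v v)"
  by (simp add: f0_def matrix_vector_mult_add_rdistrib inner_add_right inner_matrix_vector_left
      matrix_vector_mul_assoc matrix_mul_assoc)

lemma f0_psd: "X \<in> psd \<Longrightarrow> F0 X \<in> psd"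
  unfolding f0_def by (intro psd_add psd_congruence Q_psd)

lemma f0_mono:
  assumes "X \<preceq>\<^sub>L Y"
  shows "F0 X \<preceq>\<^sub>L F0 Y"
proof -
  have "F0 Y - F0 X = A ** (Y - X) ** transpose A"
    by (simp add: f0_def matrix_eq matrix_vector_mult_diff_rdistrib
        matrix_vector_mult_diff_distrib matrix_vector_mult_add_rdistrib flip: matrix_vector_mul_assoc)
  then show ?thesis
    using assms psd_congruence by (simp add: loewner_le_def)
qed

text \<open>Completing the square in \<open>u\<close>: \<^term>\<open>f1 A Q C R X\<close> is the minimal cost.\<close>

lemma f1_form:
  assumes X: "X \<in> psd"
  defines "S \<equiv> C ** X ** transpose C + R"
  defines "k v \<equiv> matrix_inv S *v ((C ** X ** transpose A) *v v)"
  shows "v \<bullet> (F1 X *v v) = cost X v u - (u - k v) \<bullet> (S *v (u - k v))"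
proof -
  have S: "pos_definite S" unfolding S_def using X by (rule innovation_pos_definite)
  then have Ssym: "transpose S = S" by (simp add: pos_definite_def)
  have Sk: "S *v k v = (C ** X ** transpose A) *v v"
    by (simp add: k_def matrix_vector_mul_assoc matrix_inv_mult pos_definite_invertible[OF S]
        matrix_mul_assoc)
  define a where "a = transpose A *v v"
  define b where "b = transpose C *v u"
  define z where "z = (C ** X ** transpose A) *v v"
  have Xsym: "b \<bullet> (X *v a) = a \<bullet> (X *v b)"
    using inner_matrix_vector_left[of X b a] X by (simp add: psd_symmetric inner_commute)
  have zu: "u \<bullet> z = b \<bullet> (X *v a)"
    by (simp add: z_def a_def b_def inner_matrix_vector_left matrix_vector_mul_assoc matrix_mul_assoc)
  have vz: "v \<bullet> ((A ** X ** transpose C ** matrix_inv S ** C ** X ** transpose A) *v v) = z \<bullet> k v"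
    by (simp add: z_def k_def inner_matrix_vector_left matrix_transpose_mul psd_symmetric[OF X]
        matrix_vector_mul_assoc matrix_mul_assoc)
  have uSu: "u \<bullet> (S *v u) = b \<bullet> (X *v b) + u \<bullet> (R *v u)"
    by (simp add: S_def b_def matrix_vector_mult_add_rdistrib inner_add_right
        inner_matrix_vector_left matrix_vector_mul_assoc matrix_mul_assoc)
  have kSu: "k v \<bullet> (S *v u) = u \<bullet> z"
    using inner_matrix_vector_left[of S "k v" u] by (simp add: Sk Ssym z_def inner_commute)
  have "v \<bullet> (F1 X *v v) = a \<bullet> (X *v a) + v \<bullet> (Q *v v) - z \<bullet> k v"
    using f0_form[of v X] vz
    by (simp add: f1_def f0_def S_def a_def matrix_vector_mult_diff_rdistrib inner_diff_right)
  moreover have "cost X v u = a \<bullet> (X *v a) - 2 * (u \<bullet> z) + b \<bullet> (X *v b) + v \<bullet> (Q *v v) + u \<bullet> (R *v u)"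
    by (simp add: cost_def zu Xsym matrix_vector_mult_diff_distrib inner_diff_left inner_diff_right
        flip: a_def b_def)
  moreover have "(u - k v) \<bullet> (S *v (u - k v)) = u \<bullet> (S *v u) - 2 * (u \<bullet> z) + z \<bullet> k v"
    using Sk by (simp add: matrix_vector_mult_diff_distrib inner_diff_left inner_diff_right kSu
        inner_commute[of "k v" z] flip: z_def)
  ultimately show ?thesis by (simp add: uSu)
qed

lemma f1_le_cost:
  assumes "X \<in> psd"
  shows "v \<bullet> (F1 X *v v) \<le> cost X v u"
  using f1_form[OF assms, of v u] innovation_pos_definite[OF assms]
    psd_nonneg[OF pos_definite_imp_psd] by force

text \<open>The square subtracted in \<open>f1_form\<close> vanishes at
  \<open>u = k v\<close>.\<close>

lemma f1_attains_cost:
  assumes "X \<in> psd"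
  obtains u where "v \<bullet> (F1 X *v v) = cost X v u"
  using f1_form[OF assms, of v] by (metis diff_self diff_zero inner_zero_left)

lemma cost_mono: "X \<preceq>\<^sub>L Y \<Longrightarrow> cost X v u \<le> cost Y v u"
  by (auto simp: cost_def intro: loewner_leD)

lemma f1_symmetric:
  assumes X: "X \<in> psd"
  shows "transpose (F1 X) = F1 X"
proof -
  have S: "pos_definite (C ** X ** transpose C + R)" using X by (rule innovation_pos_definite)
  then have "transpose (matrix_inv (C ** X ** transpose C + R)) = matrix_inv (C ** X ** transpose C + R)"
    by (intro transpose_matrix_inv pos_definite_invertible) (simp_all add: pos_definite_def)
  then show ?thesis
    using Q_psd
    by (simp add: f1_def transpose_add transpose_minus matrix_transpose_mul psd_symmetric[OF X]
        psd_symmetric matrix_mul_assoc)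
qed

lemma Q_le_f1:
  assumes X: "X \<in> psd"
  shows "Q \<preceq>\<^sub>L F1 X"
proof -
  have "v \<bullet> (Q *v v) \<le> v \<bullet> (F1 X *v v)" for v
  proof -
    obtain u where "v \<bullet> (F1 X *v v) = cost X v u" using X by (rule f1_attains_cost)
    then show ?thesis
      by (simp add: cost_def psd_nonneg X R_psd)
  qed
  then show ?thesis
    by (simp add: loewner_le_iff f1_symmetric X psd_symmetric Q_psd)
qed

lemma f1_psd:
  assumes "X \<in> psd"
  shows "F1 X \<in> psd"
  using psd_add[OF Q_psd, of "F1 X - Q"] Q_le_f1[OF assms] by (simp add: loewner_le_def)

text \<open>The control that is optimal for \<open>Y\<close> can be used for \<open>X\<close> and
  costs no more there.\<close>

lemma f1_mono:
  assumes X: "X \<in> psd" and Y: "Y \<in> psd" and XY: "X \<preceq>\<^sub>L Y"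
  shows "F1 X \<preceq>\<^sub>L F1 Y"
proof -
  have "v \<bullet> (F1 X *v v) \<le> v \<bullet> (F1 Y *v v)" for v
  proof -
    obtain u where "v \<bullet> (F1 Y *v v) = cost Y v u" using Y by (rule f1_attains_cost)
    then show ?thesis
      using f1_le_cost[OF X, of v u] cost_mono[OF XY, of v u] by linarith
  qed
  then show ?thesis by (simp add: loewner_le_iff f1_symmetric X Y)
qed

lemma f1_le_f0:
  assumes X: "X \<in> psd"
  shows "F1 X \<preceq>\<^sub>L F0 X"
proof -
  have "cost X v 0 = v \<bullet> (F0 X *v v)" for v by (simp add: cost_def f0_form)
  then show ?thesis
    using f1_le_cost[OF X, of _ 0] by (simp add: loewner_le_iff f1_symmetric X f0_psd psd_symmetric)
qed

lemma continuous_on_f0: "continuous_on S F0"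
  unfolding f0_def by (intro continuous_intros)

lemma continuous_on_f1: "continuous_on psd F1"
  unfolding f1_def
  by (intro continuous_intros pos_definite_invertible innovation_pos_definite)

lemma f0_power_psd: "X \<in> psd \<Longrightarrow> (F0 ^^ n) X \<in> psd"
  by (induction n) (auto intro: f0_psd)

lemma f1_power_psd: "X \<in> psd \<Longrightarrow> (F1 ^^ n) X \<in> psd"
  by (induction n) (auto intro: f1_psd)

subsection \<open>Uniform bounds from observability\<close>

text \<open>The hypothesis says that the controls \<open>u i\<close> steer \<open>v\<close> to 0 in
  \<open>n\<close> steps of the adjoint system. Following them costs a fixed amount, and
  \<open>X\<close> enters only through the final state, which is 0.\<close>

lemma f1_power_form_bounded:
  assumes "(((*v) (transpose A)) ^^ n) v = (\<Sum>i<n. (((*v) (transpose A)) ^^ i) (transpose C *v u i))"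
  shows "\<exists>b. \<forall>X\<in>psd. v \<bullet> ((F1 ^^ n) X *v v) \<le> b"
  using assms
proof (induction n arbitrary: v)
  case 0
  then show ?case by auto
next
  case (Suc n)
  \<comment> \<open>The control with the highest index acts first, because the outermost
    \<open>F1\<close> is the first step taken from \<open>v\<close>.\<close>
  let ?w = "transpose A *v v - transpose C *v u n"
  have "(((*v) (transpose A)) ^^ n) ?w = (\<Sum>i<n. (((*v) (transpose A)) ^^ i) (transpose C *v u i))"
    using Suc.prems by (simp add: linear_diff[OF linear_funpow_matrix] funpow_swap1)
  then obtain b where b: "\<forall>X\<in>psd. ?w \<bullet> ((F1 ^^ n) X *v ?w) \<le> b" using Suc.IH by blast
  have "v \<bullet> ((F1 ^^ Suc n) X *v v) \<le> b + v \<bullet> (Q *v v) + u n \<bullet> (R *v u n)" if "X \<in> psd" for X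
    using f1_le_cost[OF f1_power_psd[OF that], of v n "u n"] bspec[OF b that]
    by (simp add: cost_def)
  then show ?case by blast
qed

text \<open>The sums of this shape form a subspace. It contains the rows of all blocks
  \<open>C ** mat_power A k\<close>, which span the space by observability.\<close>

lemma observable_span:
  assumes "observable C A"
  obtains u where "v = (\<Sum>i<CARD('n). (((*v) (transpose A)) ^^ i) (transpose C *v u i))"
proof -
  let ?B = "\<Union>k<CARD('n). rows (C ** mat_power A k)"
  define g where "g u = (\<Sum>i<CARD('n). (((*v) (transpose A)) ^^ i) (transpose C *v u i))" for u
  have lin: "linear (((*v) (transpose A)) ^^ n)" for n by (rule linear_funpow_matrix)
  have tr: "transpose (C ** mat_power A k) *v w = (((*v) (transpose A)) ^^ k) (transpose C *v w)" for k w
  proof -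
    have "transpose (mat_power A k) *v x = (((*v) (transpose A)) ^^ k) x" for x
    proof (induction k arbitrary: x)
      case 0
      then show ?case by (simp add: mat_power_def)
    next
      case (Suc k)
      have "mat_power A (Suc k) = A ** mat_power A k" by (simp add: mat_power_def)
      then have "transpose (mat_power A (Suc k)) *v x = transpose (mat_power A k) *v (transpose A *v x)"
        by (simp add: matrix_transpose_mul matrix_vector_mul_assoc)
      then show ?case using Suc by (simp add: funpow_swap1)
    qed
    then show ?thesis by (simp add: matrix_transpose_mul flip: matrix_vector_mul_assoc)
  qed
  have "subspace (range g)"
  proof (rule subspaceI)
    have "g (\<lambda>_. 0) = 0" by (simp add: g_def linear_0[OF lin])
    then show "0 \<in> range g" by (metis rangeI)
  next
    fix x y assume "x \<in> range g" "y \<in> range g"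
    then obtain p q where "x = g p" "y = g q" by auto
    then have "x + y = g (\<lambda>i. p i + q i)"
      by (simp add: g_def linear_add[OF lin] matrix_vector_right_distrib sum.distrib)
    then show "x + y \<in> range g" by blast
  next
    fix c x assume "x \<in> range g"
    then obtain p where "x = g p" by auto
    then have "c *\<^sub>R x = g (\<lambda>i. c *\<^sub>R p i)"
      by (simp add: g_def linear_scale[OF lin] matrix_vector_mult_scaleR scaleR_sum_right)
    then show "c *\<^sub>R x \<in> range g" by blast
  qed
  moreover have "?B \<subseteq> range g"
  proof
    fix r assume "r \<in> ?B"
    then obtain k i where k: "k < CARD('n)" and r: "r = row i (C ** mat_power A k)"
      by (auto simp: rows_def)
    have "r = transpose (C ** mat_power A k) *v axis i 1"
      by (simp add: r matrix_vector_mult_basis column_transpose)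
    also have "\<dots> = (((*v) (transpose A)) ^^ k) (transpose C *v axis i 1)"
      by (rule tr)
    also have "\<dots> = g (\<lambda>j. if j = k then axis i 1 else 0)"
    proof -
      have "g (\<lambda>j. if j = k then axis i 1 else 0) =
        (\<Sum>j<CARD('n). if j = k then (((*v) (transpose A)) ^^ k) (transpose C *v axis i 1) else 0)"
        unfolding g_def by (rule sum.cong) (auto simp: linear_0[OF lin])
      then show ?thesis using k by (simp add: g_def)
    qed
    finally show "r \<in> range g" by blast
  qed
  ultimately have "span ?B \<subseteq> range g" by (rule span_minimal[rotated])
  moreover have "span ?B = UNIV"
    using assms dim_eq_full[of ?B] by (simp add: observable_def)
  ultimately show thesis using that unfolding g_def by blast
qed

text \<open>The bound from steering depends on \<open>v\<close> in an unspecified way, so it is used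
  on coordinate vectors only: it bounds the diagonal entries, Cauchy-Schwarz the others, and the
  entries bound the operator norm.\<close>

lemma f1_power_bounded:
  assumes "observable C A"
  obtains b where "0 \<le> b" "\<And>X v. X \<in> psd \<Longrightarrow> v \<bullet> ((F1 ^^ CARD('n)) X *v v) \<le> b * (norm v)\<^sup>2"
proof -
  let ?N = "CARD('n)"
  have "\<exists>b. \<forall>X\<in>psd. v \<bullet> ((F1 ^^ ?N) X *v v) \<le> b" for v
  proof -
    \<comment> \<open>\<open>observable_span\<close> is applied to the image of \<open>v\<close>
      under \<open>?N\<close> steps of \<open>transpose A\<close>.\<close>
    obtain u where "(((*v) (transpose A)) ^^ ?N) v = (\<Sum>i<?N. (((*v) (transpose A)) ^^ i) (transpose C *v u i))"
      using assms by (rule observable_span)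
    then show ?thesis by (rule f1_power_form_bounded)
  qed
  then obtain b where b: "\<And>v X. X \<in> psd \<Longrightarrow> v \<bullet> ((F1 ^^ ?N) X *v v) \<le> b v" by metis
  define c where "c = (\<Sum>i\<in>(UNIV::'n set). b (axis i 1))"
  \<comment> \<open>The zero matrix lies in the cone, so no bound \<open>b v\<close> is negative;
    hence \<open>c\<close> dominates each of its summands.\<close>
  have b0: "0 \<le> b v" for v
    using b[OF psd_0, of v] psd_nonneg[OF f1_power_psd[OF psd_0], of v ?N] by linarith
  show thesis
  proof (rule that[of "real ?N * (real ?N * c)"])
    show "0 \<le> real ?N * (real ?N * c)" by (simp add: c_def b0 sum_nonneg)
    fix X :: "real^'n^'n" and v :: "real^'n" assume X: "X \<in> psd"
    let ?Y = "(F1 ^^ ?N) X"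
    have Y: "?Y \<in> psd" using X by (rule f1_power_psd)
    have c0: "0 \<le> c" by (simp add: c_def b0 sum_nonneg)
    have entry: "\<bar>?Y $ i $ j\<bar> \<le> c" for i j
    proof -
      have d: "0 \<le> axis l 1 \<bullet> (?Y *v axis l 1)" "axis l 1 \<bullet> (?Y *v axis l 1) \<le> c" for l
      proof -
        show "0 \<le> axis l 1 \<bullet> (?Y *v axis l 1)" using Y by (rule psd_nonneg)
        have "b (axis l 1) \<le> c" unfolding c_def by (rule member_le_sum) (auto simp: b0)
        then show "axis l 1 \<bullet> (?Y *v axis l 1) \<le> c" using b[OF X, of "axis l 1"] by simp
      qed
      have "(?Y $ i $ j)\<^sup>2 = (axis i 1 \<bullet> (?Y *v axis j 1))\<^sup>2"
        by (simp add: matrix_vector_mult_basis column_def inner_axis' )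
      also have "\<dots> \<le> (axis i 1 \<bullet> (?Y *v axis i 1)) * (axis j 1 \<bullet> (?Y *v axis j 1))"
        using Y by (rule psd_cauchy_schwarz)
      also have "\<dots> \<le> c * c"
        by (rule mult_mono) (auto intro: d c0)
      finally show ?thesis
        using c0 by (simp add: abs_le_square_iff[of _ c, unfolded abs_of_nonneg[OF c0]] power2_eq_square)
    qed
    have "v \<bullet> (?Y *v v) \<le> norm v * norm (?Y *v v)" by (rule norm_cauchy_schwarz)
    also have "\<dots> \<le> norm v * ((real ?N * (real ?N * c)) * norm v)"
    proof (rule mult_left_mono)
      have "norm (?Y *v v) \<le> spectral_norm ?Y * norm v" by (rule norm_matrix_vector_le)
      also have "spectral_norm ?Y \<le> real ?N * real ?N * c"
        unfolding spectral_norm_def by (rule onorm_le_matrix_component) (rule entry)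
      finally show "norm (?Y *v v) \<le> (real ?N * (real ?N * c)) * norm v"
        by (simp add: mult_right_mono mult.assoc)
    qed simp
    finally show "v \<bullet> (?Y *v v) \<le> (real ?N * (real ?N * c)) * (norm v)\<^sup>2"
      by (simp add: power2_eq_square mult_ac)
  qed
qed

end

section \<open>Convergence to the fixed point\<close>

locale riccati_fixed_point = riccati A Q C R
  for A Q :: "real^'n^'n" and C :: "real^'n^'m" and R :: "real^'m^'m" +
  fixes P :: "real^'n^'n"
  assumes P_psd: "P \<in> psd" and f1_P: "F1 P = P"
begin

lemma contraction_factor:
  obtains r where "0 < r" "r < 1" "\<And>v. (1 - r) * (v \<bullet> (P *v v)) \<le> v \<bullet> (Q *v v)"
proof -
  obtain c where c: "0 < c" "\<And>v. c * (norm v)\<^sup>2 \<le> v \<bullet> (Q *v v)"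
    using Q_pos by (rule pos_definite_coercive) auto
  let ?p = "spectral_norm P"
  \<comment> \<open>The cap 1/2 keeps \<open>1 - q\<close> positive, and the added 1 keeps the
    denominator positive.\<close>
  define q where "q = min (1/2) (c / (?p + 1))"
  have p: "0 \<le> ?p" by (rule spectral_norm_nonneg)
  have q: "0 < q" "q < 1" using c(1) p by (auto simp: q_def)
  have qp: "q * ?p \<le> c"
  proof -
    have "q * ?p \<le> c / (?p + 1) * (?p + 1)"
      using c(1) p by (intro mult_mono) (auto simp: q_def)
    then show ?thesis using p by simp
  qed
  have "q * (v \<bullet> (P *v v)) \<le> v \<bullet> (Q *v v)" for v
  proof -
    have "v \<bullet> (P *v v) \<le> norm v * norm (P *v v)" by (rule norm_cauchy_schwarz)
    also have "\<dots> \<le> norm v * (?p * norm v)" by (intro mult_left_mono norm_matrix_vector_le) simp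
    finally have "q * (v \<bullet> (P *v v)) \<le> q * (?p * (norm v)\<^sup>2)"
      using q by (intro mult_left_mono) (simp_all add: power2_eq_square mult_ac)
    also have "\<dots> \<le> c * (norm v)\<^sup>2"
      using qp by (simp add: mult_right_mono flip: mult.assoc)
    finally show ?thesis using c(2)[of v] by linarith
  qed
  then show thesis using q by (intro that[of "1 - q"]) auto
qed

text \<open>The control optimal for \<open>P\<close> is used for \<open>X\<close>. Only the state
  term is inflated by \<open>1 + s\<close>, so \<open>s\<close> times the \<open>Q\<close> term is
  saved, at least \<open>s * (1 - r)\<close> times the form of \<open>P\<close>.\<close>

lemma f1_upper_contraction:
  assumes r: "\<And>v. (1 - r) * (v \<bullet> (P *v v)) \<le> v \<bullet> (Q *v v)"
    and s: "0 \<le> s" and X: "X \<in> psd" "\<And>v. v \<bullet> (X *v v) \<le> (1 + s) * (v \<bullet> (P *v v))"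
  shows "v \<bullet> (F1 X *v v) \<le> (1 + s * r) * (v \<bullet> (P *v v))"
proof -
  obtain u where u: "v \<bullet> (P *v v) = cost P v u"
    using f1_attains_cost[OF P_psd] f1_P by metis
  let ?w = "transpose A *v v - transpose C *v u"
  have "v \<bullet> (F1 X *v v) \<le> cost X v u" using X(1) by (rule f1_le_cost)
  also have "\<dots> \<le> (1 + s) * (?w \<bullet> (P *v ?w)) + v \<bullet> (Q *v v) + u \<bullet> (R *v u)"
    unfolding cost_def using X(2)[of ?w] by simp
  also have "\<dots> = (1 + s) * cost P v u - s * (v \<bullet> (Q *v v)) - s * (u \<bullet> (R *v u))"
    by (simp add: cost_def algebra_simps)
  also have "\<dots> \<le> (1 + s) * (v \<bullet> (P *v v)) - s * ((1 - r) * (v \<bullet> (P *v v)))"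
    using mult_left_mono[OF r s, of v] mult_nonneg_nonneg[OF s psd_nonneg[OF R_psd, of u]]
    by (simp add: u)
  finally show ?thesis by (simp add: algebra_simps)
qed

text \<open>The mirror argument, with the control optimal for \<open>X\<close>. An inequality is
  multiplied by \<open>1 - s\<close>, whence \<open>s \<le> 1\<close>.\<close>

lemma f1_lower_contraction:
  assumes r: "\<And>v. (1 - r) * (v \<bullet> (P *v v)) \<le> v \<bullet> (Q *v v)"
    and s: "0 \<le> s" and X: "X \<in> psd" "\<And>v. (1 - s) * (v \<bullet> (P *v v)) \<le> v \<bullet> (X *v v)"
    and s1: "s \<le> 1"
  shows "(1 - s * r) * (v \<bullet> (P *v v)) \<le> v \<bullet> (F1 X *v v)"
proof -
  obtain u where u: "v \<bullet> (F1 X *v v) = cost X v u"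
    using f1_attains_cost[OF X(1)] by metis
  let ?w = "transpose A *v v - transpose C *v u"
  have le: "v \<bullet> (P *v v) \<le> cost P v u" using f1_le_cost[OF P_psd] f1_P by metis
  have "(1 - s * r) * (v \<bullet> (P *v v)) = (1 - s) * (v \<bullet> (P *v v)) + s * ((1 - r) * (v \<bullet> (P *v v)))"
    by (simp add: algebra_simps)
  also have "\<dots> \<le> (1 - s) * cost P v u + s * (v \<bullet> (Q *v v)) + s * (u \<bullet> (R *v u))"
    using mult_left_mono[OF r s, of v] mult_nonneg_nonneg[OF s psd_nonneg[OF R_psd, of u]]
      mult_left_mono[OF le, of "1 - s"] s1
    by simp
  also have "\<dots> = (1 - s) * (?w \<bullet> (P *v ?w)) + v \<bullet> (Q *v v) + u \<bullet> (R *v u)"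
    by (simp add: cost_def algebra_simps)
  also have "\<dots> \<le> cost X v u"
    unfolding cost_def using X(2)[of ?w] by simp
  finally show ?thesis by (simp add: u)
qed

text \<open>\<open>Y - P\<close> may be indefinite, whereas \<open>spectral_norm_mono\<close> asks
  for a psd left side. Adding \<open>t *\<^sub>R P\<close> moves it between 0 and
  \<open>(2 * t) *\<^sub>R P\<close>; undoing the shift costs one more \<open>t\<close>, hence the
  3.\<close>

lemma spectral_norm_diff_le:
  assumes t: "0 \<le> t" and Y: "Y \<in> psd"
    and lower: "\<And>v. (1 - t) * (v \<bullet> (P *v v)) \<le> v \<bullet> (Y *v v)"
    and upper: "\<And>v. v \<bullet> (Y *v v) \<le> (1 + t) * (v \<bullet> (P *v v))"
  shows "spectral_norm (Y - P) \<le> 3 * t * spectral_norm P"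
proof -
  let ?D = "Y - (1 - t) *\<^sub>R P"
  have sym: "transpose ?D = ?D" "transpose ((2 * t) *\<^sub>R P) = (2 * t) *\<^sub>R P"
    using Y P_psd by (simp_all add: transpose_minus transpose_scalar psd_symmetric)
  have "?D \<in> psd"
    using lower sym by (simp add: psd_def matrix_vector_mult_diff_rdistrib inner_diff_right
        scaleR_matrix_vector)
  moreover have "?D \<preceq>\<^sub>L (2 * t) *\<^sub>R P"
    unfolding loewner_le_iff[OF sym]
    using upper by (simp add: matrix_vector_mult_diff_rdistrib inner_diff_right
        scaleR_matrix_vector algebra_simps)
  ultimately have "spectral_norm ?D \<le> 2 * t * spectral_norm P"
    using spectral_norm_mono[of ?D "(2 * t) *\<^sub>R P"] t by (simp add: spectral_norm_scaleR)
  moreover have "spectral_norm (Y - P) \<le> spectral_norm ?D + spectral_norm ((- t) *\<^sub>R P)"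
    using spectral_norm_triangle[of ?D "(- t) *\<^sub>R P"] by (simp add: algebra_simps)
  moreover have "spectral_norm ((- t) *\<^sub>R P) = t * spectral_norm P"
    using t by (simp only: spectral_norm_scaleR) simp
  ultimately show ?thesis by (simp add: algebra_simps)
qed

lemma f1_power_bounded_by_fixed_point:
  assumes "observable C A"
  obtains s where "1 \<le> s"
    "\<And>X v. X \<in> psd \<Longrightarrow> v \<bullet> ((F1 ^^ CARD('n)) X *v v) \<le> (1 + s) * (v \<bullet> (P *v v))"
proof -
  obtain b where b: "0 \<le> b" "\<And>X v. X \<in> psd \<Longrightarrow> v \<bullet> ((F1 ^^ CARD('n)) X *v v) \<le> b * (norm v)\<^sup>2"
    using assms by (rule f1_power_bounded) auto
  obtain c where c: "0 < c" "\<And>v. c * (norm v)\<^sup>2 \<le> v \<bullet> (Q *v v)"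
    using Q_pos by (rule pos_definite_coercive) auto
  have QP: "v \<bullet> (Q *v v) \<le> v \<bullet> (P *v v)" for v
    using loewner_leD[OF Q_le_f1[OF P_psd]] f1_P by simp
  \<comment> \<open>The extra 1 secures \<open>1 \<le> s\<close>, with which
    \<open>s * r ^ n\<close> later dominates the error from below.\<close>
  show thesis
  proof (rule that[of "1 + b / c"])
    show "1 \<le> 1 + b / c" using b(1) c(1) by simp
    fix X :: "real^'n^'n" and v :: "real^'n" assume X: "X \<in> psd"
    have "b * (norm v)\<^sup>2 = b / c * (c * (norm v)\<^sup>2)" using c(1) by simp
    also have "\<dots> \<le> b / c * (v \<bullet> (P *v v))"
      using b(1) c(1) order_trans[OF c(2) QP] by (intro mult_left_mono) auto
    also have "\<dots> \<le> (1 + (1 + b / c)) * (v \<bullet> (P *v v))"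
      using psd_nonneg[OF P_psd] by (intro mult_right_mono) auto
    finally show "v \<bullet> ((F1 ^^ CARD('n)) X *v v) \<le> (1 + (1 + b / c)) * (v \<bullet> (P *v v))"
      using b(2)[OF X, of v] by linarith
  qed
qed

lemma f1_power_uniform_convergence:
  assumes obs: "observable C A" and G: "openin (top_of_set psd) G" "P \<in> G"
  obtains l where "\<And>X. X \<in> psd \<Longrightarrow> (F1 ^^ l) X \<in> G"
proof -
  let ?N = "CARD('n)"
  obtain r where r: "0 < r" "r < 1" "\<And>v. (1 - r) * (v \<bullet> (P *v v)) \<le> v \<bullet> (Q *v v)"
    by (rule contraction_factor) auto
  obtain s where s: "1 \<le> s"
    "\<And>X v. X \<in> psd \<Longrightarrow> v \<bullet> ((F1 ^^ ?N) X *v v) \<le> (1 + s) * (v \<bullet> (P *v v))"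
    using obs by (rule f1_power_bounded_by_fixed_point) auto
  \<comment> \<open>The first \<open>?N\<close> steps bring the whole cone below
    \<open>1 + s\<close> times \<open>P\<close>; each further step multiplies the excess by
    \<open>r\<close>.\<close>
  have upper: "v \<bullet> ((F1 ^^ (n + ?N)) X *v v) \<le> (1 + s * r ^ n) * (v \<bullet> (P *v v))"
    if "X \<in> psd" for X v n
  proof (induction n arbitrary: v)
    case (Suc n)
    have "0 \<le> s * r ^ n" using s(1) r(1) by simp
    from f1_upper_contraction[OF r(3) this f1_power_psd[OF that] Suc]
    show ?case by (simp add: mult_ac)
  qed (use s(2)[OF that] in simp)
  \<comment> \<open>From below the iteration starts at once with deficit 1, since \<open>X\<close>
    is psd.\<close>
  have lower: "(1 - r ^ n) * (v \<bullet> (P *v v)) \<le> v \<bullet> ((F1 ^^ n) X *v v)" if "X \<in> psd" for X v n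
  proof (induction n arbitrary: v)
    case (Suc n)
    have "0 \<le> r ^ n" "r ^ n \<le> 1" using r by (auto intro: power_le_one)
    from f1_lower_contraction[OF r(3) this(1) f1_power_psd[OF that] Suc this(2)]
    show ?case by (simp add: mult_ac)
  qed (use psd_nonneg[OF that] in simp)
  have close: "spectral_norm ((F1 ^^ (n + ?N)) X - P) \<le> 3 * (s * r ^ n) * spectral_norm P"
    if X: "X \<in> psd" for X n
  proof (rule spectral_norm_diff_le)
    show "0 \<le> s * r ^ n" using s(1) r(1) by simp
    show "(F1 ^^ (n + ?N)) X \<in> psd" using X by (rule f1_power_psd)
    show "v \<bullet> ((F1 ^^ (n + ?N)) X *v v) \<le> (1 + s * r ^ n) * (v \<bullet> (P *v v))" for v
      using X by (rule upper)
    fix v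
    have "r ^ (n + ?N) \<le> s * r ^ n"
      using r s(1) by (simp add: power_add mult.commute mult_mono power_le_one order_trans[of _ 1])
    then have "(1 - s * r ^ n) * (v \<bullet> (P *v v)) \<le> (1 - r ^ (n + ?N)) * (v \<bullet> (P *v v))"
      using psd_nonneg[OF P_psd] by (intro mult_right_mono) auto
    also have "\<dots> \<le> v \<bullet> ((F1 ^^ (n + ?N)) X *v v)"
      using X by (rule lower)
    finally show "(1 - s * r ^ n) * (v \<bullet> (P *v v)) \<le> v \<bullet> ((F1 ^^ (n + ?N)) X *v v)" .
  qed
  obtain e where e: "0 < e" "ball P e \<inter> psd \<subseteq> G"
    using G unfolding openin_contains_ball by blast
  have "(\<lambda>n. (real ?N)\<^sup>2 * (3 * (s * r ^ n) * spectral_norm P)) \<longlonglongrightarrow> (real ?N)\<^sup>2 * (3 * (s * 0) * spectral_norm P)"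
    using r by (intro tendsto_intros LIMSEQ_realpow_zero) auto
  then have "eventually (\<lambda>n. (real ?N)\<^sup>2 * (3 * (s * r ^ n) * spectral_norm P) < e) sequentially"
    using e(1) by (intro order_tendstoD(2)) auto
  then obtain n where n: "(real ?N)\<^sup>2 * (3 * (s * r ^ n) * spectral_norm P) < e"
    by (auto simp: eventually_sequentially)
  show thesis
  proof (rule that)
    fix X :: "real^'n^'n" assume X: "X \<in> psd"
    let ?Y = "(F1 ^^ (n + ?N)) X"
    have "norm (?Y - P) \<le> (real ?N)\<^sup>2 * spectral_norm (?Y - P)" by (rule norm_le_spectral_norm)
    also have "\<dots> \<le> (real ?N)\<^sup>2 * (3 * (s * r ^ n) * spectral_norm P)"
      using close[OF X] by (intro mult_left_mono) auto
    also note n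
    finally have "?Y \<in> ball P e" by (simp add: dist_norm norm_minus_commute)
    then show "?Y \<in> G" using e(2) f1_power_psd[OF X] by blast
  qed
qed

section \<open>Orbits of the fixed point\<close>

text \<open>The head of the word is the map that is applied last.\<close>

definition word_map :: "bool list \<Rightarrow> real^'n^'n \<Rightarrow> real^'n^'n" where
  "word_map w = foldr (\<lambda>b. if b then F1 else F0) w"

lemma word_map_psd: "X \<in> psd \<Longrightarrow> word_map w X \<in> psd"
  by (induction w) (auto simp: word_map_def f0_psd f1_psd)

lemma word_map_append: "word_map (v @ w) X = word_map v (word_map w X)"
  by (simp add: word_map_def)

lemma word_map_replicate: "word_map (replicate i True) X = (F1 ^^ i) X"
  by (induction i) (auto simp: word_map_def)

lemma fixed_point_le_word_map: "P \<preceq>\<^sub>L word_map w P"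
proof (induction w)
  case Nil
  then show ?case by (simp add: word_map_def loewner_le_refl)
next
  case (Cons b w)
  have "P \<preceq>\<^sub>L F1 (word_map w P)"
    using f1_mono[OF P_psd word_map_psd[OF P_psd] Cons] by (simp add: f1_P)
  moreover from this have "P \<preceq>\<^sub>L F0 (word_map w P)"
    using f1_le_f0[OF word_map_psd[OF P_psd]] by (rule loewner_le_trans)
  ultimately show ?case by (simp add: word_map_def)
qed

text \<open>The class A condition covers only matrices above \<open>F0 P\<close>; this places all
  positive powers of \<open>F0\<close> in its range.\<close>

lemma f0_le_f0_power: "F0 P \<preceq>\<^sub>L (F0 ^^ Suc j) P"
proof (induction j)
  case (Suc j)
  have "P \<preceq>\<^sub>L F0 P" using f1_le_f0[OF P_psd] by (simp add: f1_P)
  then have "P \<preceq>\<^sub>L (F0 ^^ Suc j) P" using Suc by (rule loewner_le_trans)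
  then show ?case using f0_mono by simp
qed (simp add: loewner_le_refl)

text \<open>A letter \<open>F0\<close> raises the exponent by one. A letter \<open>F1\<close> keeps
  the bound: \<open>F1\<close> fixes \<open>P\<close>, which is the bound at exponent 0, and does
  not increase the later ones by class A.\<close>

lemma word_map_le_f0_power:
  assumes classA: "class_A A Q C R P"
  shows "word_map w P \<preceq>\<^sub>L (F0 ^^ count_list w False) P"
proof (induction w)
  case Nil
  then show ?case by (simp add: word_map_def loewner_le_refl)
next
  case (Cons b w)
  let ?j = "count_list w False"
  show ?case
  proof (cases b)
    case True
    have "F1 ((F0 ^^ ?j) P) \<preceq>\<^sub>L (F0 ^^ ?j) P"
    proof (cases ?j)
      case 0
      then show ?thesis by (simp add: f1_P loewner_le_refl)
    next
      case (Suc i)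
      then show ?thesis
        using classA f0_le_f0_power[of i] f0_power_psd[OF P_psd, of ?j] by (simp only: class_A_def)
    qed
    moreover have "F1 (word_map w P) \<preceq>\<^sub>L F1 ((F0 ^^ ?j) P)"
      by (intro f1_mono word_map_psd f0_power_psd P_psd Cons)
    ultimately show ?thesis
      using True by (auto simp: word_map_def intro: loewner_le_trans)
  next
    case False
    then show ?thesis using f0_mono[OF Cons] by (simp add: word_map_def)
  qed
qed

lemma spectral_norm_word_map_le:
  assumes "class_A A Q C R P"
  shows "spectral_norm (word_map w P - P) \<le> spectral_norm ((F0 ^^ count_list w False) P - P)"
proof (rule spectral_norm_mono)
  show "word_map w P - P \<in> psd" using fixed_point_le_word_map by (simp add: loewner_le_def)
  show "word_map w P - P \<preceq>\<^sub>L (F0 ^^ count_list w False) P - P"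
    using word_map_le_f0_power[OF assms] by (simp add: loewner_le_def)
qed

end

section \<open>Logarithmic rates\<close>

text \<open>A constant factor changes the rate by a multiple of \<open>1 / ln (1 - g)\<close>, which
  vanishes in the limit.\<close>

lemma Limsup_log_rate_le:
  fixes p :: "real \<Rightarrow> real"
  assumes "\<And>g. 0 < g \<Longrightarrow> g < 1 \<Longrightarrow> 0 \<le> p g \<and> p g \<le> c * (1 - g) ^ k"
  shows "Limsup (at_left 1) (\<lambda>g. ereal (- (1 / ln (1 - g))) * ext_ln (p g)) \<le> - ereal (real k)"
proof -
  \<comment> \<open>The sign of \<open>c\<close> is unknown; \<open>d\<close> is positive, so its
    logarithm splits off.\<close>
  define d where "d = max c 1"
  have "Limsup (at_left 1) (\<lambda>g. ereal (- (1 / ln (1 - g))) * ext_ln (p g))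
      \<le> Limsup (at_left 1) (\<lambda>g. ereal (- (ln d / ln (1 - g)) - real k))"
  proof (rule Limsup_mono)
    have "eventually (\<lambda>g. g \<in> {0<..<1}) (at_left (1::real))"
      by (rule eventually_at_left_real) simp
    then show "eventually (\<lambda>g. ereal (- (1 / ln (1 - g))) * ext_ln (p g)
        \<le> ereal (- (ln d / ln (1 - g)) - real k)) (at_left 1)"
    proof eventually_elim
      case (elim g)
      then have g: "0 < g" "g < 1" by auto
      have neg: "ln (1 - g) < 0" using g by simp
      show ?case
      proof (cases "p g = 0")
        case True
        have "0 < - (1 / ln (1 - g))" using neg by simp
        then show ?thesis using True by (simp add: ext_ln_def)
      next
        case False
        then have "0 < p g" using assms[OF g] by simp
        moreover have "p g \<le> d * (1 - g) ^ k"
          using assms[OF g] g order_trans[OF _ mult_right_mono[of c d "(1 - g) ^ k"]] by (simp add: d_def)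
        ultimately have "ln (p g) \<le> ln (d * (1 - g) ^ k)" by simp
        also have "\<dots> = ln d + real k * ln (1 - g)"
          using g by (simp add: d_def ln_mult ln_realpow)
        finally have "- (1 / ln (1 - g)) * ln (p g) \<le> - (1 / ln (1 - g)) * (ln d + real k * ln (1 - g))"
          using neg by (intro mult_left_mono) auto
        also have "\<dots> = - (ln d / ln (1 - g)) - real k" using neg by (simp add: field_simps)
        finally show ?thesis using False by (simp add: ext_ln_def)
      qed
    qed
  qed
  also have "\<dots> = ereal (- real k)"
  proof (rule lim_imp_Limsup)
    have "((\<lambda>g. - (ln d / ln (1 - g)) - real k) \<longlongrightarrow> - real k) (at_left 1)" by real_asymp
    then show "((\<lambda>g. ereal (- (ln d / ln (1 - g)) - real k)) \<longlongrightarrow> ereal (- real k)) (at_left 1)"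
      by (rule tendsto_ereal)
  qed simp
  finally show ?thesis by simp
qed

text \<open>The factor \<open>g ^ l\<close> disappears since \<open>ln g\<close> tends to 0 while
  \<open>ln (1 - g)\<close> diverges.\<close>

lemma Liminf_log_rate_ge:
  fixes p :: "real \<Rightarrow> real"
  assumes "\<And>g. 0 < g \<Longrightarrow> g < 1 \<Longrightarrow> g ^ l * (1 - g) ^ k \<le> p g"
  shows "- ereal (real k) \<le> Liminf (at_left 1) (\<lambda>g. ereal (- (1 / ln (1 - g))) * ext_ln (p g))"
proof -
  have "- ereal (real k) = Liminf (at_left 1) (\<lambda>g. ereal (- (real l * ln g / ln (1 - g)) - real k))"
  proof (rule lim_imp_Liminf[symmetric])
    have "((\<lambda>g. - (real l * ln g / ln (1 - g)) - real k) \<longlongrightarrow> - real k) (at_left 1)" by real_asymp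
    then show "((\<lambda>g. ereal (- (real l * ln g / ln (1 - g)) - real k)) \<longlongrightarrow> - ereal (real k)) (at_left 1)"
      using tendsto_ereal by force
  qed simp
  also have "\<dots> \<le> Liminf (at_left 1) (\<lambda>g. ereal (- (1 / ln (1 - g))) * ext_ln (p g))"
  proof (rule Liminf_mono)
    have "eventually (\<lambda>g. g \<in> {0<..<1}) (at_left (1::real))"
      by (rule eventually_at_left_real) simp
    then show "eventually (\<lambda>g. ereal (- (real l * ln g / ln (1 - g)) - real k)
        \<le> ereal (- (1 / ln (1 - g))) * ext_ln (p g)) (at_left 1)"
    proof eventually_elim
      case (elim g)
      then have g: "0 < g" "g < 1" by auto
      have neg: "ln (1 - g) < 0" using g by simp
      have pos: "0 < g ^ l * (1 - g) ^ k" using g by simp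
      have p: "0 < p g" using pos assms[OF g] by linarith
      have "- (real l * ln g / ln (1 - g)) - real k = - (1 / ln (1 - g)) * (real l * ln g + real k * ln (1 - g))"
        using neg by (simp add: field_simps)
      also have "real l * ln g + real k * ln (1 - g) = ln (g ^ l * (1 - g) ^ k)"
        using g by (simp add: ln_mult ln_realpow)
      also have "- (1 / ln (1 - g)) * \<dots> \<le> - (1 / ln (1 - g)) * ln (p g)"
        using neg pos p assms[OF g] by (intro mult_left_mono) auto
      finally show ?case using p by (simp add: ext_ln_def)
    qed
  qed
  finally show ?thesis .
qed

section \<open>Tail bounds for invariant measures\<close>

lemma openin_psd_sets:
  assumes "openin (top_of_set psd) G"
  shows "G \<in> sets psd_borel"
proof -
  obtain T where "open T" "G = psd \<inter> T" using assms unfolding openin_open by blast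
  then show ?thesis unfolding psd_borel_def sets_restrict_space by (intro image_eqI) auto
qed

lemma space_psd_borel: "space psd_borel = psd"
  by (simp add: psd_borel_def space_restrict_space)

section \<open>Preimages under the two maps and the invariance identity\<close>

context riccati
begin

abbreviation pre :: "(real^'n^'n \<Rightarrow> real^'n^'n) \<Rightarrow> (real^'n^'n) set \<Rightarrow> (real^'n^'n) set" where
  "pre f G \<equiv> {X \<in> psd. f X \<in> G}"

lemma openin_pre:
  assumes "f = F0 \<or> f = F1" "openin (top_of_set psd) G"
  shows "openin (top_of_set psd) (pre f G)"
proof -
  have "openin (top_of_set psd) (psd \<inter> f -` G)"
    using assms continuous_on_f0 continuous_on_f1 f0_psd f1_psd
    by (intro continuous_openin_preimage) auto
  then show ?thesis by (simp add: vimage_def Int_def)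
qed

lemma openin_pre_power:
  assumes "f = F0 \<or> f = F1" "openin (top_of_set psd) G"
  shows "openin (top_of_set psd) (pre (f ^^ n) G)"
proof (induction n)
  case 0
  have "pre (f ^^ 0) G = G" using openin_imp_subset[OF assms(2)] by auto
  then show ?case using assms(2) by simp
next
  case (Suc n)
  have "pre (f ^^ Suc n) G = pre f (pre (f ^^ n) G)"
    using assms(1) by (auto simp: funpow_swap1 f0_psd f1_psd)
  then show ?case using openin_pre[OF assms(1) Suc] by simp
qed

lemma sets_pre:
  assumes "f = F0 \<or> f = F1" "B \<in> sets psd_borel"
  shows "pre f B \<in> sets psd_borel"
proof -
  have "continuous_on psd f" using assms(1) continuous_on_f0 continuous_on_f1 by auto
  then have "f \<in> psd_borel \<rightarrow>\<^sub>M borel"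
    unfolding psd_borel_def by (rule borel_measurable_continuous_on_restrict)
  moreover have "f \<in> space psd_borel \<rightarrow> psd"
    using assms(1) f0_psd f1_psd by (auto simp: space_psd_borel)
  ultimately have "f \<in> psd_borel \<rightarrow>\<^sub>M psd_borel"
    unfolding psd_borel_def by (intro measurable_restrict_space2)
  then have "f -` B \<inter> space psd_borel \<in> sets psd_borel" using assms(2) by (rule measurable_sets)
  then show ?thesis by (simp add: space_psd_borel vimage_def Int_def conj_commute)
qed

text \<open>The kernel mixes two point masses, so the integral reduces to the masses of two
  preimages. Both tail bounds use invariance in this form.\<close>

lemma invariant_prob_measure:
  assumes inv: "invariant_prob A Q C R g \<nu>" and g: "0 < g" "g < 1" and B: "B \<in> sets psd_borel"
  shows "measure \<nu> B = g * measure \<nu> (pre F1 B) + (1 - g) * measure \<nu> (pre F0 B)"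
proof -
  have sets_eq: "sets \<nu> = sets psd_borel" using inv by (simp add: invariant_prob_def)
  interpret prob_space \<nu> using inv by (simp add: invariant_prob_def)
  have space_eq: "space \<nu> = psd" using sets_eq_imp_space_eq[OF sets_eq] by (simp add: space_psd_borel)
  have kernel: "emeasure (riccati_kernel A Q C R g X) B =
      ennreal g * indicator (pre F1 B) X + ennreal (1 - g) * indicator (pre F0 B) X"
    if "X \<in> space \<nu>" for X
  proof -
    have X: "X \<in> psd" using that by (simp add: space_eq)
    let ?f = "\<lambda>b. if b then F1 X else F0 X"
    have "?f \<in> measure_pmf (bernoulli_pmf g) \<rightarrow>\<^sub>M psd_borel"
      using X f0_psd f1_psd by (auto simp: space_psd_borel)
    then have "emeasure (riccati_kernel A Q C R g X) B = emeasure (measure_pmf (bernoulli_pmf g)) (?f -` B)"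
      unfolding riccati_kernel_def using B by (simp add: emeasure_distr)
    also have "\<dots> = (\<integral>\<^sup>+b. indicator (?f -` B) b \<partial>measure_pmf (bernoulli_pmf g))"
      by simp
    also have "\<dots> = indicator (?f -` B) True * ennreal g + indicator (?f -` B) False * ennreal (1 - g)"
      using g by (subst nn_integral_bernoulli_pmf) (auto simp: ennreal_minus)
    finally show ?thesis using X by (simp add: indicator_def mult.commute)
  qed
  have pre_sets: "pre F1 B \<in> sets \<nu>" "pre F0 B \<in> sets \<nu>"
    using sets_pre B by (auto simp: sets_eq)
  have "emeasure \<nu> B = (\<integral>\<^sup>+X. emeasure (riccati_kernel A Q C R g X) B \<partial>\<nu>)"
    using inv B by (simp add: invariant_prob_def)
  also have "\<dots> = (\<integral>\<^sup>+X. ennreal g * indicator (pre F1 B) X + ennreal (1 - g) * indicator (pre F0 B) X \<partial>\<nu>)"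
    by (rule nn_integral_cong) (rule kernel)
  also have "\<dots> = ennreal g * emeasure \<nu> (pre F1 B) + ennreal (1 - g) * emeasure \<nu> (pre F0 B)"
    using pre_sets by (subst nn_integral_add) (simp_all add: nn_integral_cmult_indicator)
  also have "\<dots> = ennreal (g * measure \<nu> (pre F1 B) + (1 - g) * measure \<nu> (pre F0 B))"
    using g by (simp add: emeasure_eq_measure ennreal_mult ennreal_plus)
  finally have "ennreal (measure \<nu> B) = ennreal (g * measure \<nu> (pre F1 B) + (1 - g) * measure \<nu> (pre F0 B))"
    by (simp only: emeasure_eq_measure)
  then show ?thesis
    using g by (subst (asm) ennreal_inj) (auto intro: add_nonneg_nonneg mult_nonneg_nonneg)
qed

end

section \<open>Upper and lower bounds of order \<open>(1 - g) ^ k\<close>\<close>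

context riccati_fixed_point
begin

text \<open>\<open>G\<close> varies in the induction. \<open>c\<close> is chosen before
  \<open>g\<close> and \<open>\<nu>\<close>, so that it disappears in the logarithmic rate.\<close>

lemma invariant_prob_tail_upper:
  assumes obs: "observable C A"
    and "openin (top_of_set psd) G"
    and "\<And>w. count_list w False < k \<Longrightarrow> word_map w P \<in> G"
  shows "\<exists>c. \<forall>g \<nu>. 0 < g \<longrightarrow> g < 1 \<longrightarrow> invariant_prob A Q C R g \<nu> \<longrightarrow>
    measure \<nu> (psd - G) \<le> c * (1 - g) ^ k"
  using assms(2,3)
proof (induction k arbitrary: G)
  case 0
  have "measure \<nu> (psd - G) \<le> 1" if "invariant_prob A Q C R g \<nu>" for g \<nu>
    using that by (simp add: invariant_prob_def prob_space.prob_le_1)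
  then show ?case by (intro exI[of _ 1]) auto
next
  case (Suc k)
  have G: "openin (top_of_set psd) G" by fact
  have "P \<in> G" using Suc.prems(2)[of "[]"] by (simp add: word_map_def)
  then obtain l where l: "\<And>X. X \<in> psd \<Longrightarrow> (F1 ^^ l) X \<in> G"
    by (rule f1_power_uniform_convergence[OF obs G]) auto
  define H where "H i = pre F0 (pre (F1 ^^ i) G)" for i
  have "\<exists>c. \<forall>g \<nu>. 0 < g \<longrightarrow> g < 1 \<longrightarrow> invariant_prob A Q C R g \<nu> \<longrightarrow>
      measure \<nu> (psd - H i) \<le> c * (1 - g) ^ k" for i
  proof (rule Suc.IH)
    show "openin (top_of_set psd) (H i)"
      unfolding H_def by (intro openin_pre openin_pre_power G) auto
    fix w assume w: "count_list w False < k"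
    \<comment> \<open>The rightmost letters act first. The word has one \<open>False\<close> more
      than \<open>w\<close>, hence fewer than \<open>Suc k\<close>.\<close>
    have "word_map (replicate i True @ False # w) P \<in> G"
      by (rule Suc.prems(2)) (use w in \<open>simp add: count_list_0_iff\<close>)
    moreover have "word_map (replicate i True @ False # w) P = (F1 ^^ i) (F0 (word_map w P))"
      by (simp add: word_map_append word_map_replicate) (simp add: word_map_def)
    ultimately show "word_map w P \<in> H i"
      by (simp add: H_def word_map_psd P_psd f0_psd)
  qed
  then obtain c where c: "\<And>i g \<nu>. 0 < g \<Longrightarrow> g < 1 \<Longrightarrow> invariant_prob A Q C R g \<nu> \<Longrightarrow>
      measure \<nu> (psd - H i) \<le> c i * (1 - g) ^ k" by metis
  have "measure \<nu> (psd - G) \<le> (\<Sum>i<l. c i) * (1 - g) ^ Suc k"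
    if g: "0 < g" "g < 1" and inv: "invariant_prob A Q C R g \<nu>" for g \<nu>
  proof -
    \<comment> \<open>The last steps are peeled off one by one. An \<open>F0\<close> preceding
      \<open>n\<close> steps \<open>F1\<close> costs a factor \<open>1 - g\<close> and the bound for
      \<open>H n\<close>; an \<open>F1\<close> continues the peeling, its weight \<open>g\<close>
      being bounded by 1.\<close>
    have "measure \<nu> (psd - pre (F1 ^^ 0) G) \<le>
      (\<Sum>i<n. c i) * (1 - g) ^ Suc k + measure \<nu> (psd - pre (F1 ^^ n) G)" for n
    proof (induction n)
      case (Suc n)
      let ?B = "psd - pre (F1 ^^ n) G"
      have B: "?B \<in> sets psd_borel"
        using sets.compl_sets[OF openin_psd_sets[OF openin_pre_power[OF _ G]], of F1 n]
        by (simp add: space_psd_borel)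
      have "pre F1 ?B = psd - pre (F1 ^^ Suc n) G"
        by (auto simp: funpow_swap1 f1_psd)
      moreover have "pre F0 ?B = psd - H n"
        by (auto simp: H_def f0_psd)
      ultimately have "measure \<nu> ?B = g * measure \<nu> (psd - pre (F1 ^^ Suc n) G) + (1 - g) * measure \<nu> (psd - H n)"
        using invariant_prob_measure[OF inv g B] by simp
      also have "\<dots> \<le> 1 * measure \<nu> (psd - pre (F1 ^^ Suc n) G) + (1 - g) * (c n * (1 - g) ^ k)"
        using g by (intro add_mono mult_mono c inv) auto
      finally show ?case using Suc.IH by (simp add: algebra_simps)
    qed simp
    \<comment> \<open>At \<open>n = l\<close> the remaining set is empty by the choice of
      \<open>l\<close>.\<close>
    from this[of l] have "measure \<nu> (psd - pre (F1 ^^ 0) G) \<le> (\<Sum>i<l. c i) * (1 - g) ^ Suc k"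
      using l by (simp add: set_diff_eq)
    moreover have "psd - G = psd - pre (F1 ^^ 0) G" by auto
    ultimately show ?thesis by simp
  qed
  then show ?case by blast
qed

text \<open>At each step only one term of the invariance identity is kept: \<open>F0\<close> in the
  last \<open>k\<close> steps, \<open>F1\<close> in the \<open>l\<close> steps before. Uniform
  convergence makes \<open>l\<close> independent of \<open>g\<close> and of the starting
  point.\<close>

lemma invariant_prob_open_lower:
  assumes obs: "observable C A" and G: "openin (top_of_set psd) G" and "(F0 ^^ k) P \<in> G"
  obtains l where "\<And>g \<nu>. 0 < g \<Longrightarrow> g < 1 \<Longrightarrow> invariant_prob A Q C R g \<nu> \<Longrightarrow>
    g ^ l * (1 - g) ^ k \<le> measure \<nu> G"
proof -
  let ?U = "pre (F0 ^^ k) G"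
  have U: "openin (top_of_set psd) ?U" using G by (intro openin_pre_power) auto
  moreover have "P \<in> ?U" using P_psd assms(3) by simp
  ultimately obtain l where l: "\<And>X. X \<in> psd \<Longrightarrow> (F1 ^^ l) X \<in> ?U"
    by (rule f1_power_uniform_convergence[OF obs]) auto
  show thesis
  proof (rule that)
    fix g \<nu> assume g: "0 < g" "g < 1" and inv: "invariant_prob A Q C R g \<nu>"
    have sets_eq: "sets \<nu> = sets psd_borel" using inv by (simp add: invariant_prob_def)
    interpret prob_space \<nu> using inv by (simp add: invariant_prob_def)
    have space_eq: "space \<nu> = psd" using sets_eq_imp_space_eq[OF sets_eq] by (simp add: space_psd_borel)
    have step: "q * measure \<nu> (pre f B) \<le> measure \<nu> B"
      if "f = F0 \<and> q = 1 - g \<or> f = F1 \<and> q = g" and "openin (top_of_set psd) B" for f q B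
      using that g invariant_prob_measure[OF inv g openin_psd_sets[OF that(2)]] by auto
    have iter: "q ^ n * measure \<nu> (pre (f ^^ n) B) \<le> measure \<nu> B"
      if f: "f = F0 \<and> q = 1 - g \<or> f = F1 \<and> q = g" and B: "openin (top_of_set psd) B" for f q B n
    proof (induction n)
      case 0
      have "pre (f ^^ 0) B = B" using openin_imp_subset[OF B] by auto
      then show ?case by simp
    next
      case (Suc n)
      have "pre (f ^^ Suc n) B = pre f (pre (f ^^ n) B)"
        using f by (auto simp: funpow_swap1 f0_psd f1_psd)
      moreover have "q * measure \<nu> (pre f (pre (f ^^ n) B)) \<le> measure \<nu> (pre (f ^^ n) B)"
        using f B by (intro step openin_pre_power) auto
      ultimately have "q ^ Suc n * measure \<nu> (pre (f ^^ Suc n) B) \<le> q ^ n * measure \<nu> (pre (f ^^ n) B)"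
        using f g mult_left_mono[of "q * measure \<nu> (pre f (pre (f ^^ n) B))" _ "q ^ n"]
        by (auto simp: mult_ac)
      then show ?case using Suc by linarith
    qed
    have "pre (F1 ^^ l) ?U = psd" using l by auto
    then have "g ^ l \<le> measure \<nu> ?U"
      using iter[of F1 g ?U l] U prob_space by (simp add: space_eq)
    then have "(1 - g) ^ k * g ^ l \<le> (1 - g) ^ k * measure \<nu> ?U"
      using g by (intro mult_left_mono) auto
    also have "\<dots> \<le> measure \<nu> G" using G by (intro iter) auto
    finally show "g ^ l * (1 - g) ^ k \<le> measure \<nu> G" by (simp add: mult.commute)
  qed
qed

end

section \<open>From the tail bounds to the two rates\<close>

theorem mainTheorem5:
  fixes A Q Pstar :: "real^'n^'n"
    and C :: "real^'n^'m"
    and R :: "real^'m^'m"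
    and \<mu> :: "real \<Rightarrow> (real^'n^'n) measure"
    and M :: real
  assumes "observable C A"
    and "pos_definite Q"
    and "pos_definite R"
    and "Pstar \<in> psd" and "f1 A Q C R Pstar = Pstar"
    and "class_A A Q C R Pstar"
    and "\<And>g. 0 < g \<Longrightarrow> g < 1 \<Longrightarrow> invariant_prob A Q C R g (\<mu> g)"
    and "M > 0"
  shows "Limsup (at_left 1)
           (\<lambda>g. ereal (- (1 / ln (1 - g))) *
                ext_ln (measure (\<mu> g) {X \<in> psd. spectral_norm (X - Pstar) \<ge> M}))
         \<le> - iota A Q Pstar M
       \<and> Liminf (at_left 1)
           (\<lambda>g. ereal (- (1 / ln (1 - g))) *
                ext_ln (measure (\<mu> g) {X \<in> psd. spectral_norm (X - Pstar) > M}))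
         \<ge> - iota_plus A Q Pstar M"
proof
  interpret riccati_fixed_point A Q C R Pstar
    using assms by unfold_locales
  have cont: "continuous_on psd (\<lambda>X. spectral_norm (X - Pstar))"
    by (intro continuous_intros)
  let ?sup = "Limsup (at_left 1)
     (\<lambda>g. ereal (- (1 / ln (1 - g))) *
          ext_ln (measure (\<mu> g) {X \<in> psd. spectral_norm (X - Pstar) \<ge> M}))"
  \<comment> \<open>Stated for every \<open>k\<close> up to the first exit from the ball, so that it
    also serves when the orbit never leaves.\<close>
  have upper: "?sup \<le> - ereal (real k)"
    if k: "\<And>j. j < k \<Longrightarrow> spectral_norm ((F0 ^^ j) Pstar - Pstar) < M" for k
  proof -
    let ?G = "psd \<inter> (\<lambda>X. spectral_norm (X - Pstar)) -` {..<M}"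
    have "openin (top_of_set psd) ?G" using cont by (intro continuous_openin_preimage_gen) auto
    moreover have "word_map w Pstar \<in> ?G" if "count_list w False < k" for w
      using spectral_norm_word_map_le[OF assms(6), of w] k[OF that] word_map_psd[OF P_psd] by simp
    ultimately obtain c where c: "\<And>g \<nu>. 0 < g \<Longrightarrow> g < 1 \<Longrightarrow> invariant_prob A Q C R g \<nu> \<Longrightarrow>
        measure \<nu> (psd - ?G) \<le> c * (1 - g) ^ k"
      using invariant_prob_tail_upper[OF assms(1)] by metis
    moreover have "psd - ?G = {X \<in> psd. spectral_norm (X - Pstar) \<ge> M}" by auto
    ultimately show ?thesis using assms(7) by (intro Limsup_log_rate_le[where c = c]) auto
  qed
  show "?sup \<le> - iota A Q Pstar M"
  proof (cases "\<exists>k. spectral_norm ((F0 ^^ k) Pstar - Pstar) \<ge> M")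
    case True
    define k where "k = (LEAST k. spectral_norm ((F0 ^^ k) Pstar - Pstar) \<ge> M)"
    have "spectral_norm ((F0 ^^ k) Pstar - Pstar) \<ge> M" unfolding k_def by (rule LeastI_ex) fact
    then have "iota A Q Pstar M \<le> ereal (real k)"
      unfolding iota_def by (intro Inf_lower) auto
    moreover have "?sup \<le> - ereal (real k)"
      by (rule upper) (metis k_def not_le not_less_Least)
    ultimately show ?thesis by (meson ereal_minus_le_minus order_trans)
  next
    case False
    \<comment> \<open>Here \<open>iota\<close> is \<open>\<infinity>\<close>, and
      \<open>upper\<close> holds for every \<open>k\<close>, which pushes the limit superior below
      every real.\<close>
    have "?sup \<le> ereal B" for B
    proof -
      obtain k where "- B \<le> real k" using real_arch_simple by blast
      then have "- ereal (real k) \<le> ereal B" by simp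
      moreover have "?sup \<le> - ereal (real k)"
        using False by (intro upper) (auto simp: not_le)
      ultimately show ?thesis by (rule order_trans[rotated])
    qed
    then have "?sup = - \<infinity>" by (rule ereal_bot)
    then show ?thesis by simp
  qed
  let ?inf = "Liminf (at_left 1)
     (\<lambda>g. ereal (- (1 / ln (1 - g))) *
          ext_ln (measure (\<mu> g) {X \<in> psd. spectral_norm (X - Pstar) > M}))"
  have lower: "- ereal (real k) \<le> ?inf" if k: "spectral_norm ((F0 ^^ k) Pstar - Pstar) > M" for k
  proof -
    let ?G = "psd \<inter> (\<lambda>X. spectral_norm (X - Pstar)) -` {M<..}"
    have "openin (top_of_set psd) ?G" using cont by (intro continuous_openin_preimage_gen) auto
    moreover have "(F0 ^^ k) Pstar \<in> ?G" using k f0_power_psd[OF P_psd] by simp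
    ultimately obtain l where "\<And>g \<nu>. 0 < g \<Longrightarrow> g < 1 \<Longrightarrow> invariant_prob A Q C R g \<nu> \<Longrightarrow>
        g ^ l * (1 - g) ^ k \<le> measure \<nu> ?G"
      using invariant_prob_open_lower[OF assms(1)] by metis
    moreover have "?G = {X \<in> psd. spectral_norm (X - Pstar) > M}" by auto
    ultimately show ?thesis using assms(7) by (intro Liminf_log_rate_ge[where l = l]) auto
  qed
  \<comment> \<open>The bound for each admissible \<open>k\<close> passes to the infimum, also when
    it is \<open>\<infinity>\<close> over the empty set.\<close>
  have "- ?inf \<le> iota_plus A Q Pstar M"
    unfolding iota_plus_def
  proof (rule Inf_greatest)
    fix x assume "x \<in> {ereal (real k) | k. spectral_norm ((F0 ^^ k) Pstar - Pstar) > M}"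
    then obtain k where "x = ereal (real k)" "spectral_norm ((F0 ^^ k) Pstar - Pstar) > M" by auto
    then show "- ?inf \<le> x" using lower[of k] by (simp only: ereal_uminus_le_reorder)
  qed
  then show "- iota_plus A Q Pstar M \<le> ?inf"
    by (simp only: ereal_uminus_le_reorder)
qed

end
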